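(* (Strong normalization.) If $\Gamma;\Delta\vdash t:\rho$, then $t$ is strongly normalizing, i.e. there is a bound on the length of all reduction sequences $t\to t_1\to t_2\to\cdots$ starting at $t$.
   Context: Calculus $\lambda^{::}_{\mathtt{catch}}$. Types: $\sigma,\tau,\rho ::= \mathtt{unit} \mid \mathtt{list}\,\tau \mid \sigma\to\tau$. A type is arrow-free if it contains no $\to$; $\psi$ ranges over arrow-free types. Terms: $t,r,s ::= x \mid () \mid \mathtt{nil} \mid (::) \mid \mathtt{lrec} \mid \lambda x.r \mid t\,s \mid \mathtt{catch}\,\alpha\,t \mid \mathtt{throw}\,\alpha\,t$ ($x$ variables, $\alpha,\beta$ continuation variables; $\lambda x$ binds $x$, $\mathtt{catch}\,\alpha$ binds $\alpha$; application left-associative; $t::r$ abbreviates $(::)\,t\,r$). $\mathrm{FCV}$ = free continuation variables, $t[x:=r]$ capture-avoiding substitution. Values: $v,w ::= x \mid () \mid \mathtt{nil} \mid (::) \mid (::)\,v \mid (::)\,v\,w \mid \mathtt{lrec} \mid \mathtt{lrec}\,v \mid \mathtt{lrec}\,v\,w \mid \lambda x.r$. Contexts $E ::= \Box\,t \mid v\,\Box \mid \mathtt{throw}\,\alpha\,\Box$. Reduction $\to$ is the compatible closure of: $(\lambda x.t)\,v\to t[x:=v]$; $E[\mathtt{throw}\,\alpha\,t]\to\mathtt{throw}\,\alpha\,t$; $\mathtt{catch}\,\alpha\,(\mathtt{throw}\,\alpha\,t)\to\mathtt{catch}\,\alpha\,t$; $\mathtt{catch}\,\alpha\,(\mathtt{throw}\,\beta\,v)\to\mathtt{throw}\,\beta\,v$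 if $\alpha\notin\{\beta\}\cup\mathrm{FCV}(v)$; $\mathtt{catch}\,\alpha\,v\to v$ if $\alpha\notin\mathrm{FCV}(v)$; $\mathtt{lrec}\,v_r\,v_s\,\mathtt{nil}\to v_r$; $\mathtt{lrec}\,v_r\,v_s\,(v_h::v_t)\to v_s\,v_h\,v_t\,(\mathtt{lrec}\,v_r\,v_s\,v_t)$. Typing $\Gamma;\Delta\vdash t:\rho$ ($\Gamma$ maps variables to types, $\Delta$ maps continuation variables to arrow-free types): $x:\rho$ if $x:\rho\in\Gamma$; $():\mathtt{unit}$; $\mathtt{nil}:\mathtt{list}\,\sigma$; $(::):\sigma\to\mathtt{list}\,\sigma\to\mathtt{list}\,\sigma$; $\mathtt{lrec}:\rho\to(\sigma\to\mathtt{list}\,\sigma\to\rho\to\rho)\to\mathtt{list}\,\sigma\to\rho$; if $\Gamma,x:\sigma;\Delta\vdash t:\tau$ then $\Gamma;\Delta\vdash\lambda x.t:\sigma\to\tau$; if $\Gamma;\Delta\vdash t:\sigma\to\tau$ and $\Gamma;\Delta\vdash s:\sigma$ then $\Gamma;\Delta\vdash ts:\tau$; if $\Gamma;\Delta,\alpha:\psi\vdash t:\psi$ then $\Gamma;\Delta\vdash\mathtt{catch}\,\alpha\,t:\psi$; if $\Gamma;\Delta\vdash t:\psi$ and $\alpha:\psi\in\Delta$ then $\Gamma;\Delta\vdash\mathtt{throw}\,\alpha\,t:\tau$ for any $\tau$. *)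

theory Defs
  imports Main
begin

datatype ty = Unit_ty | List_ty ty | Arrow ty ty  (infixr \<open>\<rightarrow>\<close> 200)

fun arrow_free :: "ty \<Rightarrow> bool" where
  "arrow_free Unit_ty = True"
| "arrow_free (List_ty \<tau>) = arrow_free \<tau>"
| "arrow_free (\<sigma> \<rightarrow> \<tau>) = False"

text \<open>
  Terms up to renaming of bound variables, with two independent families of de Bruijn
  indices: those of \<open>Var\<close> count enclosing \<open>Lam\<close>s only, those of \<open>Throw\<close> count enclosing
  \<open>Catch\<close>es only.
\<close>

datatype trm =
    Var nat
  | Unit
  | Nl
  | Cns
  | LRec
  | Lam trm
  | App trm trm  (infixl \<open>\<degree>\<close> 200)
  | Catch trm
  | Throw nat trm

fun fcv :: "trm \<Rightarrow> nat set" where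
  "fcv (Var i) = {}"
| "fcv Unit = {}"
| "fcv Nl = {}"
| "fcv Cns = {}"
| "fcv LRec = {}"
| "fcv (Lam t) = fcv t"
| "fcv (t \<degree> s) = fcv t \<union> fcv s"
| "fcv (Catch t) = {\<alpha>. Suc \<alpha> \<in> fcv t}"
| "fcv (Throw \<alpha> t) = insert \<alpha> (fcv t)"

text \<open>Weakening by a fresh variable, respectively a fresh continuation variable, at index \<open>k\<close>.\<close>

fun lift :: "nat \<Rightarrow> trm \<Rightarrow> trm" where
  "lift k (Var i) = Var (if i < k then i else Suc i)"
| "lift k Unit = Unit"
| "lift k Nl = Nl"
| "lift k Cns = Cns"
| "lift k LRec = LRec"
| "lift k (Lam t) = Lam (lift (Suc k) t)"
| "lift k (t \<degree> s) = lift k t \<degree> lift k s"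
| "lift k (Catch t) = Catch (lift k t)"
| "lift k (Throw \<alpha> t) = Throw \<alpha> (lift k t)"

fun clift :: "nat \<Rightarrow> trm \<Rightarrow> trm" where
  "clift k (Var i) = Var i"
| "clift k Unit = Unit"
| "clift k Nl = Nl"
| "clift k Cns = Cns"
| "clift k LRec = LRec"
| "clift k (Lam t) = Lam (clift k t)"
| "clift k (t \<degree> s) = clift k t \<degree> clift k s"
| "clift k (Catch t) = Catch (clift (Suc k) t)"
| "clift k (Throw \<alpha> t) = Throw (if \<alpha> < k then \<alpha> else Suc \<alpha>) (clift k t)"

text \<open>
  Strengthening: the re-indexing needed when the binder of continuation variable \<open>k\<close> is
  dropped.  Only meaningful for \<open>k \<notin> fcv t\<close>, where it inverts \<open>clift k\<close>.
\<close>

fun clower :: "nat \<Rightarrow> trm \<Rightarrow> trm" where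
  "clower k (Var i) = Var i"
| "clower k Unit = Unit"
| "clower k Nl = Nl"
| "clower k Cns = Cns"
| "clower k LRec = LRec"
| "clower k (Lam t) = Lam (clower k t)"
| "clower k (t \<degree> s) = clower k t \<degree> clower k s"
| "clower k (Catch t) = Catch (clower (Suc k) t)"
| "clower k (Throw \<alpha> t) = Throw (if \<alpha> \<le> k then \<alpha> else \<alpha> - 1) (clower k t)"

lemma clower_clift: "clower k (clift k t) = t"
  by (induction t arbitrary: k) auto

lemma clift_clower: "k \<notin> fcv t \<Longrightarrow> clift k (clower k t) = t"
  by (induction t arbitrary: k) auto

lemma notin_fcv_clift: "k \<notin> fcv (clift k t)"
  by (induction t arbitrary: k) auto

text \<open>
  \<open>subst t k s\<close> replaces variable \<open>k\<close> of \<open>t\<close> by \<open>s\<close> and removes \<open>k\<close> from the context.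
\<close>

fun subst :: "trm \<Rightarrow> nat \<Rightarrow> trm \<Rightarrow> trm" where
  "subst (Var i) k s = (if i < k then Var i else if i = k then s else Var (i - 1))"
| "subst Unit k s = Unit"
| "subst Nl k s = Nl"
| "subst Cns k s = Cns"
| "subst LRec k s = LRec"
| "subst (Lam t) k s = Lam (subst t (Suc k) (lift 0 s))"
| "subst (t \<degree> r) k s = subst t k s \<degree> subst r k s"
| "subst (Catch t) k s = Catch (subst t k (clift 0 s))"
| "subst (Throw \<alpha> t) k s = Throw \<alpha> (subst t k s)"

inductive val :: "trm \<Rightarrow> bool" where
  "val (Var i)"
| "val Unit"
| "val Nl"
| "val Cns"
| "val v \<Longrightarrow> val (Cns \<degree> v)"
| "val v \<Longrightarrow> val w \<Longrightarrow> val (Cns \<degree> v \<degree> w)"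
| "val LRec"
| "val v \<Longrightarrow> val (LRec \<degree> v)"
| "val v \<Longrightarrow> val w \<Longrightarrow> val (LRec \<degree> v \<degree> w)"
| "val (Lam r)"

datatype ctx = AppL_ctx trm | AppR_ctx trm | Throw_ctx nat

fun wf_ctx :: "ctx \<Rightarrow> bool" where
  "wf_ctx (AppL_ctx t) = True"
| "wf_ctx (AppR_ctx v) = val v"
| "wf_ctx (Throw_ctx \<alpha>) = True"

fun fill :: "ctx \<Rightarrow> trm \<Rightarrow> trm" where
  "fill (AppL_ctx t) s = s \<degree> t"
| "fill (AppR_ctx v) s = v \<degree> s"
| "fill (Throw_ctx \<alpha>) s = Throw \<alpha> s"

inductive contract :: "trm \<Rightarrow> trm \<Rightarrow> bool" where
  beta: "val v \<Longrightarrow> contract (Lam t \<degree> v) (subst t 0 v)"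
| throw: "wf_ctx E \<Longrightarrow> contract (fill E (Throw \<alpha> t)) (Throw \<alpha> t)"
| catch_throw_same: "contract (Catch (Throw 0 t)) (Catch t)"
| catch_throw_other: "val v \<Longrightarrow> 0 \<notin> {\<beta>} \<union> fcv v \<Longrightarrow>
    contract (Catch (Throw \<beta> v)) (clower 0 (Throw \<beta> v))"
| catch_val: "val v \<Longrightarrow> 0 \<notin> fcv v \<Longrightarrow> contract (Catch v) (clower 0 v)"
| lrec_nil: "val v\<^sub>r \<Longrightarrow> val v\<^sub>s \<Longrightarrow> contract (LRec \<degree> v\<^sub>r \<degree> v\<^sub>s \<degree> Nl) v\<^sub>r"
| lrec_cons: "val v\<^sub>r \<Longrightarrow> val v\<^sub>s \<Longrightarrow> val v\<^sub>h \<Longrightarrow> val v\<^sub>t \<Longrightarrow>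
    contract (LRec \<degree> v\<^sub>r \<degree> v\<^sub>s \<degree> (Cns \<degree> v\<^sub>h \<degree> v\<^sub>t))
      (v\<^sub>s \<degree> v\<^sub>h \<degree> v\<^sub>t \<degree> (LRec \<degree> v\<^sub>r \<degree> v\<^sub>s \<degree> v\<^sub>t))"

inductive red :: "trm \<Rightarrow> trm \<Rightarrow> bool" where
  contract: "contract t t' \<Longrightarrow> red t t'"
| lam: "red t t' \<Longrightarrow> red (Lam t) (Lam t')"
| appL: "red t t' \<Longrightarrow> red (t \<degree> s) (t' \<degree> s)"
| appR: "red s s' \<Longrightarrow> red (t \<degree> s) (t \<degree> s')"
| catch: "red t t' \<Longrightarrow> red (Catch t) (Catch t')"
| throw: "red t t' \<Longrightarrow> red (Throw \<alpha> t) (Throw \<alpha> t')"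

inductive typing :: "ty list \<Rightarrow> ty list \<Rightarrow> trm \<Rightarrow> ty \<Rightarrow> bool" where
  var: "i < length \<Gamma> \<Longrightarrow> \<Gamma> ! i = \<rho> \<Longrightarrow> typing \<Gamma> \<Delta> (Var i) \<rho>"
| unit: "typing \<Gamma> \<Delta> Unit Unit_ty"
| nil: "typing \<Gamma> \<Delta> Nl (List_ty \<sigma>)"
| cons: "typing \<Gamma> \<Delta> Cns (\<sigma> \<rightarrow> List_ty \<sigma> \<rightarrow> List_ty \<sigma>)"
| lrec: "typing \<Gamma> \<Delta> LRec (\<rho> \<rightarrow> (\<sigma> \<rightarrow> List_ty \<sigma> \<rightarrow> \<rho> \<rightarrow> \<rho>) \<rightarrow> List_ty \<sigma> \<rightarrow> \<rho>)"
| lam: "typing (\<sigma> # \<Gamma>) \<Delta> t \<tau> \<Longrightarrow> typing \<Gamma> \<Delta> (Lam t) (\<sigma> \<rightarrow> \<tau>)"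
| app: "typing \<Gamma> \<Delta> t (\<sigma> \<rightarrow> \<tau>) \<Longrightarrow> typing \<Gamma> \<Delta> s \<sigma> \<Longrightarrow> typing \<Gamma> \<Delta> (t \<degree> s) \<tau>"
| catch: "arrow_free \<psi> \<Longrightarrow> typing \<Gamma> (\<psi> # \<Delta>) t \<psi> \<Longrightarrow> typing \<Gamma> \<Delta> (Catch t) \<psi>"
| throw: "arrow_free \<psi> \<Longrightarrow> typing \<Gamma> \<Delta> t \<psi> \<Longrightarrow> \<alpha> < length \<Delta> \<Longrightarrow> \<Delta> ! \<alpha> = \<psi> \<Longrightarrow>
    typing \<Gamma> \<Delta> (Throw \<alpha> t) \<tau>"

definition strongly_normalizing :: "trm \<Rightarrow> bool" where
  "strongly_normalizing t \<longleftrightarrow> (\<exists>n. \<forall>k u. (red ^^ k) t u \<longrightarrow> k \<le> n)"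

end

theory Submission
  imports Defs
begin

text \<open>
  Call-by-value reducibility: reducible values \<open>RV \<tau>\<close> are defined by recursion on types, and a
  term is reducible if it is strongly normalizing and reduces only to reducible values.  A
  \<open>Throw\<close> never becomes a value, so it is reducible at every type once its argument is
  strongly normalizing.  For arrow-free \<open>\<psi>\<close> reducibility at \<open>\<psi>\<close> is just strong normalization,
  so the types of thrown terms impose no further condition and \<open>Catch\<close> only has to preserve
  strong normalization.  Substituting below \<open>Catch\<close> shifts continuation variables; this is
  harmless because reduction neither creates nor loses steps under any, even non-injective,
  renaming of the free continuation variables.  Finite branching turns well-founded reduction
  into a bound on the lengths of reduction sequences.
\<close>

section \<open>Renaming and substitution\<close>

definition cup :: "(nat \<Rightarrow> nat) \<Rightarrow> nat \<Rightarrow> nat" where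
  "cup f \<alpha> = (case \<alpha> of 0 \<Rightarrow> 0 | Suc n \<Rightarrow> Suc (f n))"

lemma cup_simps [simp]: "cup f 0 = 0" "cup f (Suc n) = Suc (f n)"
  by (simp_all add: cup_def)

lemma cup_eq_0_iff [simp]: "cup f \<alpha> = 0 \<longleftrightarrow> \<alpha> = 0" "0 = cup f \<alpha> \<longleftrightarrow> \<alpha> = 0"
  by (cases \<alpha>; simp)+

lemma cup_comp: "cup f \<circ> cup g = cup (f \<circ> g)"
  by (rule ext) (simp add: cup_def split: nat.split)

text \<open>Renamings are arbitrary functions, so that weakening and the constant map that collapses
  all free continuation variables are handled alike.\<close>

fun crename :: "(nat \<Rightarrow> nat) \<Rightarrow> trm \<Rightarrow> trm" where
  "crename f (Var i) = Var i"
| "crename f Unit = Unit"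
| "crename f Nl = Nl"
| "crename f Cns = Cns"
| "crename f LRec = LRec"
| "crename f (Lam t) = Lam (crename f t)"
| "crename f (t \<degree> s) = crename f t \<degree> crename f s"
| "crename f (Catch t) = Catch (crename (cup f) t)"
| "crename f (Throw \<alpha> t) = Throw (f \<alpha>) (crename f t)"

lemma crename_crename: "crename f (crename g t) = crename (f \<circ> g) t"
  by (induction t arbitrary: f g) (auto simp: cup_comp)

lemma clift_eq_crename: "clift k t = crename (\<lambda>\<alpha>. if \<alpha> < k then \<alpha> else Suc \<alpha>) t"
proof (induction t arbitrary: k)
  case (Catch t)
  have "(\<lambda>\<alpha>. if \<alpha> < Suc k then \<alpha> else Suc \<alpha>) = cup (\<lambda>\<alpha>. if \<alpha> < k then \<alpha> else Suc \<alpha>)"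
    by (rule ext) (simp add: cup_def split: nat.split)
  with Catch show ?case by simp
qed auto

lemma clift_0_eq_crename: "clift 0 = crename Suc"
  by (rule ext) (simp add: clift_eq_crename)

lemma crename_cup_clift: "crename (cup f) (clift 0 t) = clift 0 (crename f t)"
  by (simp add: clift_0_eq_crename crename_crename comp_def)

lemma crename_lift: "crename f (lift k t) = lift k (crename f t)"
  by (induction t arbitrary: f k) auto

lemma crename_subst: "crename f (subst t k s) = subst (crename f t) k (crename f s)"
  by (induction t arbitrary: f k s) (auto simp: crename_lift crename_cup_clift)

text \<open>Whatever \<open>f\<close> is, \<open>cup f\<close> maps only 0 to 0. Hence the freshness
  condition of the \<open>Catch\<close> rules that drop the binder is stable under every
  renaming.\<close>

lemma zero_in_fcv_crename_iff: "0 \<in> fcv (crename (cup f) t) \<longleftrightarrow> 0 \<in> fcv t"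
proof -
  \<comment> \<open>Being the sole preimage of itself is the property of \<open>k\<close> that
    survives passing under \<open>Catch\<close>, where \<open>k\<close> becomes
    \<open>Suc k\<close>.\<close>
  have "k \<in> fcv (crename f t) \<longleftrightarrow> k \<in> fcv t" if "\<And>\<alpha>. f \<alpha> = k \<longleftrightarrow> \<alpha> = k" for k f
    using that
  proof (induction t arbitrary: f k)
    case (Catch t)
    have "\<And>\<alpha>. cup f \<alpha> = Suc k \<longleftrightarrow> \<alpha> = Suc k"
      using Catch.prems by (simp add: cup_def split: nat.split)
    with Catch.IH show ?case by simp
  next
    case (Throw \<alpha> t)
    have "k = f \<alpha> \<longleftrightarrow> k = \<alpha>"
      using Throw.prems by metis
    with Throw show ?case by simp
  qed auto
  then show ?thesis by simp
qed

lemma clift_lift: "clift i (lift k t) = lift k (clift i t)"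
  by (simp add: clift_eq_crename crename_lift)

lemma lift_lift: "i \<le> k \<Longrightarrow> lift (Suc k) (lift i t) = lift i (lift k t)"
  by (induction t arbitrary: i k) auto

lemma subst_lift: "subst (lift k t) k s = t"
  by (induction t arbitrary: k s) auto

lemma lift_subst: "i \<le> k \<Longrightarrow> lift i (subst t k s) = subst (lift i t) (Suc k) (lift i s)"
  by (induction t arbitrary: i k s) (auto simp: lift_lift clift_lift)

lemma clift_subst: "clift i (subst t k s) = subst (clift i t) k (clift i s)"
  by (simp add: clift_eq_crename crename_subst)

text \<open>The substitution lemma for de Bruijn terms; it makes beta contraction stable under
  substitution.\<close>

lemma subst_subst:
  "i \<le> k \<Longrightarrow>
    subst (subst t i v) k w = subst (subst t (Suc k) (lift i w)) i (subst v k w)"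
  by (induction t arbitrary: i k v w)
    (auto simp: lift_lift lift_subst clift_subst subst_lift clift_lift)

text \<open>Substitution is simultaneous because the induction on typing replaces all free variables
  at once; \<open>\<theta>\<close> is total, so \<open>Var\<close> serves as the identity.\<close>

fun psubst :: "trm \<Rightarrow> (nat \<Rightarrow> trm) \<Rightarrow> trm" where
  "psubst (Var i) \<theta> = \<theta> i"
| "psubst Unit \<theta> = Unit"
| "psubst Nl \<theta> = Nl"
| "psubst Cns \<theta> = Cns"
| "psubst LRec \<theta> = LRec"
| "psubst (Lam t) \<theta> = Lam (psubst t (case_nat (Var 0) (\<lambda>i. lift 0 (\<theta> i))))"
| "psubst (t \<degree> r) \<theta> = psubst t \<theta> \<degree> psubst r \<theta>"
| "psubst (Catch t) \<theta> = Catch (psubst t (\<lambda>i. clift 0 (\<theta> i)))"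
| "psubst (Throw \<alpha> t) \<theta> = Throw \<alpha> (psubst t \<theta>)"

lemma psubst_Var: "psubst t Var = t"
proof (induction t)
  case (Lam t)
  have "case_nat (Var 0) (\<lambda>i. lift 0 (Var i)) = Var"
    by (rule ext) (simp split: nat.split)
  with Lam show ?case by simp
qed auto

lemma subst_psubst: "subst (psubst t \<theta>) k w = psubst t (\<lambda>i. subst (\<theta> i) k w)"
proof (induction t arbitrary: \<theta> k w)
  case (Lam t)
  have "(\<lambda>i. subst (case_nat (Var 0) (\<lambda>i. lift 0 (\<theta> i)) i) (Suc k) (lift 0 w))
      = case_nat (Var 0) (\<lambda>i. lift 0 (subst (\<theta> i) k w))"
    by (rule ext) (simp add: lift_subst split: nat.split)
  with Lam show ?case by simp
qed (auto simp: clift_subst)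

text \<open>Contracting a substituted abstraction against \<open>w\<close> amounts to extending
  \<open>\<theta>\<close> by \<open>w\<close>, the form in which the induction hypothesis for a
  \<open>Lam\<close> body applies.\<close>

lemma subst_psubst_up:
  "subst (psubst t (case_nat (Var 0) (\<lambda>i. lift 0 (\<theta> i)))) 0 w = psubst t (case_nat w \<theta>)"
proof -
  have "(\<lambda>i. subst (case_nat (Var 0) (\<lambda>i. lift 0 (\<theta> i)) i) 0 w) = case_nat w \<theta>"
    by (rule ext) (simp add: subst_lift split: nat.split)
  then show ?thesis by (simp add: subst_psubst)
qed


section \<open>Values and one-step reduction\<close>

inductive_simps val_simps [simp]:
  "val (Var i)" "val Unit" "val Nl" "val Cns" "val LRec" "val (Lam t)" "val (t \<degree> s)"
  "val (Catch t)" "val (Throw \<alpha> t)"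

lemma val_AppD: "val (t \<degree> s) \<Longrightarrow> val t \<and> val s"
  by auto

lemma crename_eq_iff [simp]:
  "crename f t = Var i \<longleftrightarrow> t = Var i"
  "crename f t = Unit \<longleftrightarrow> t = Unit"
  "crename f t = Nl \<longleftrightarrow> t = Nl"
  "crename f t = Cns \<longleftrightarrow> t = Cns"
  "crename f t = LRec \<longleftrightarrow> t = LRec"
  "crename f t = Lam a \<longleftrightarrow> (\<exists>a'. t = Lam a' \<and> a = crename f a')"
  "crename f t = a \<degree> b \<longleftrightarrow> (\<exists>a' b'. t = a' \<degree> b' \<and> a = crename f a' \<and> b = crename f b')"
  "crename f t = Throw \<alpha> a \<longleftrightarrow> (\<exists>\<beta> a'. t = Throw \<beta> a' \<and> \<alpha> = f \<beta> \<and> a = crename f a')"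
  by (cases t; auto)+

lemmas eq_crename_iff [simp] = crename_eq_iff[THEN trans[OF eq_commute]]

lemma val_crename [simp]: "val (crename f t) \<longleftrightarrow> val t"
proof
  show "val t \<Longrightarrow> val (crename f t)"
    by (induction t rule: val.induct) auto
  show "val (crename f t) \<Longrightarrow> val t"
    by (induction "crename f t" arbitrary: t rule: val.induct) auto
qed

lemma val_clift: "val t \<Longrightarrow> val (clift k t)"
  by (simp add: clift_eq_crename)

lemma val_subst: "val t \<Longrightarrow> val w \<Longrightarrow> val (subst t k w)"
  by (induction t rule: val.induct) auto

section \<open>Inversion of contraction by the head constructor\<close>

lemma contract_atom [simp]:
  "\<not> contract (Var i) u" "\<not> contract Unit u" "\<not> contract Nl u" "\<not> contract Cns u"
  "\<not> contract LRec u" "\<not> contract (Lam t) u"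
  by (auto elim!: contract.cases elim: fill.elims[OF sym])

lemma contract_App_iff:
  "contract (a \<degree> b) u \<longleftrightarrow>
    (\<exists>\<alpha> s. a = Throw \<alpha> s \<and> u = a) \<or>
    (val a \<and> (\<exists>\<alpha> s. b = Throw \<alpha> s \<and> u = b)) \<or>
    (\<exists>t. a = Lam t \<and> val b \<and> u = subst t 0 b) \<or>
    (\<exists>r s. a = LRec \<degree> r \<degree> s \<and> val r \<and> val s \<and> b = Nl \<and> u = r) \<or>
    (\<exists>r s h t. a = LRec \<degree> r \<degree> s \<and> val r \<and> val s \<and> b = Cns \<degree> h \<degree> t \<and> val h \<and> val t \<and>
      u = s \<degree> h \<degree> t \<degree> (LRec \<degree> r \<degree> s \<degree> t))"
  (is "_ \<longleftrightarrow> ?R")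
proof
  assume "contract (a \<degree> b) u"
  then show ?R
  proof cases
    case (throw E \<alpha> t)
    then show ?thesis by (cases E) auto
  qed auto
next
  assume ?R
  then show "contract (a \<degree> b) u"
    using contract.throw[of "AppL_ctx b"] contract.throw[of "AppR_ctx a"]
    by (auto intro: contract.intros)
qed

lemma contract_Throw_iff: "contract (Throw \<alpha> t) u \<longleftrightarrow> (\<exists>\<beta> s. t = Throw \<beta> s \<and> u = t)"
proof
  assume "contract (Throw \<alpha> t) u"
  then show "\<exists>\<beta> s. t = Throw \<beta> s \<and> u = t"
  proof cases
    case (throw E \<alpha> t)
    then show ?thesis by (cases E) auto
  qed
qed (use contract.throw[of "Throw_ctx \<alpha>"] in auto)

text \<open>A term avoiding continuation variable 0 is exactly a weakening. So
  \<open>t = clift 0 u\<close> replaces both the freshness condition and \<open>clower\<close>, and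
  this equation commutes with renaming and substitution.\<close>

lemma contract_Catch_iff:
  "contract (Catch t) u \<longleftrightarrow>
    (\<exists>s. t = Throw 0 s \<and> u = Catch s) \<or>
    (t = clift 0 u \<and> (val u \<or> (\<exists>\<beta> v. u = Throw \<beta> v \<and> val v)))"
  (is "_ \<longleftrightarrow> ?R")
proof
  assume "contract (Catch t) u"
  then show ?R
  proof cases
    case (throw E \<alpha> t)
    then show ?thesis by (cases E) auto
  next
    case (catch_throw_other v \<beta>)
    then have "clift 0 (clower 0 (Throw \<beta> v)) = Throw \<beta> v"
      by (intro clift_clower) auto
    moreover from catch_throw_other have "val (clower 0 v)"
      by (metis UnI2 clift_0_eq_crename clift_clower val_crename)
    ultimately show ?thesis using catch_throw_other by auto
  next
    case (catch_val)
    then have "val (clower 0 t)"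
      by (metis clift_0_eq_crename clift_clower val_crename)
    then show ?thesis using catch_val by (simp add: clift_clower)
  qed auto
next
  assume ?R
  then consider s where "t = Throw 0 s" "u = Catch s"
    | "t = clift 0 u" "val u"
    | \<beta> v where "t = clift 0 u" "u = Throw \<beta> v" "val v"
    by blast
  then show "contract (Catch t) u"
  proof cases
    case 1
    then show ?thesis by (auto intro: contract.intros)
  next
    case 2
    then have "contract (Catch t) (clower 0 t)"
      by (intro contract.catch_val) (simp_all add: notin_fcv_clift val_clift)
    then show ?thesis using 2 by (simp add: clower_clift)
  next
    case 3
    have "contract (Catch (Throw (Suc \<beta>) (clift 0 v))) (clower 0 (Throw (Suc \<beta>) (clift 0 v)))"
      using 3 by (intro contract.catch_throw_other) (simp_all add: notin_fcv_clift val_clift)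
    then show ?thesis using 3 by (simp add: clower_clift)
  qed
qed

lemmas contract_iff = contract_App_iff contract_Throw_iff contract_Catch_iff

lemma red_atom [simp]:
  "\<not> red (Var i) u" "\<not> red Unit u" "\<not> red Nl u" "\<not> red Cns u" "\<not> red LRec u"
  by (auto elim: red.cases)

inductive_simps red_Lam_iff: "red (Lam t) u"
inductive_simps red_App_iff: "red (t \<degree> s) u"
inductive_simps red_Catch_iff: "red (Catch t) u"
inductive_simps red_Throw_iff: "red (Throw \<alpha> t) u"

lemmas red_iff = red_Lam_iff red_App_iff red_Catch_iff red_Throw_iff

lemma val_not_contract: "val t \<Longrightarrow> \<not> contract t u"
  by (induction t rule: val.induct) (auto simp: contract_App_iff)

lemma red_val: "val t \<Longrightarrow> red t u \<Longrightarrow> val u"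
  by (induction t arbitrary: u rule: val.induct)
    (auto simp: red_iff contract_App_iff)

section \<open>Commutation of reduction with renaming and substitution\<close>

lemma contract_crename: "contract t u \<Longrightarrow> contract (crename f t) (crename f u)"
proof (cases t)
  case (App a b)
  moreover assume "contract t u"
  ultimately show ?thesis
    unfolding contract_App_iff App crename.simps
    by (elim disjE exE conjE) (simp_all add: crename_subst)
next
  case (Catch s)
  moreover assume "contract t u"
  ultimately show ?thesis
    unfolding contract_Catch_iff Catch crename.simps
    by (elim disjE exE conjE) (simp_all add: crename_cup_clift)
qed (auto simp: contract_Throw_iff)

lemma red_crename: "red t u \<Longrightarrow> red (crename f t) (crename f u)"
  by (induction t u arbitrary: f rule: red.induct) (auto intro: red.intros contract_crename)

text \<open>Redexes are recognised by constructors, by \<open>val\<close> and by comparison with the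
  bound index 0. Renaming reflects all three, so even a non-injective \<open>f\<close> creates no
  redex.\<close>

lemma contract_crenameD:
  assumes "contract (crename f t) u"
  shows "\<exists>u'. contract t u' \<and> u = crename f u'"
proof (cases t)
  case (App a b)
  with assms show ?thesis
    by (auto simp: contract_App_iff crename_subst[symmetric])
next
  case (Catch s)
  with assms consider s' where "s = Throw 0 s'" "u = Catch (crename (cup f) s')"
    | "crename (cup f) s = clift 0 u" "val u \<or> (\<exists>\<beta> v. u = Throw \<beta> v \<and> val v)"
    by (auto simp: contract_Catch_iff)
  then show ?thesis
  proof cases
    case 1
    then show ?thesis using Catch by (auto simp: contract_Catch_iff intro!: exI[of _ "Catch s'"])
  next
    case 2
    \<comment> \<open>Freshness pulls back along \<open>cup f\<close>, so \<open>s\<close> is itself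
      the weakening of some \<open>s'\<close>, which is the contractum sought.\<close>
    have "0 \<notin> fcv s"
      by (metis 2(1) notin_fcv_clift zero_in_fcv_crename_iff)
    then obtain s' where s': "s = clift 0 s'"
      by (metis clift_clower)
    then have "u = crename f s'"
      using 2(1) by (metis crename_cup_clift clower_clift)
    then show ?thesis
      using 2(2) Catch s' by (auto simp: contract_Catch_iff)
  qed
qed (use assms in \<open>auto simp: contract_iff\<close>)

lemma red_crenameD: "red (crename f t) u \<Longrightarrow> \<exists>u'. red t u' \<and> u = crename f u'"
proof (induction t arbitrary: f u)
  case (Lam t)
  then show ?case by (fastforce simp: red_Lam_iff)
next
  case (App a b)
  from App.prems consider "contract (crename f (a \<degree> b)) u"
    | a' where "red (crename f a) a'" "u = a' \<degree> crename f b"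
    | b' where "red (crename f b) b'" "u = crename f a \<degree> b'"
    by (auto simp: red_App_iff)
  then show ?case
  proof cases
    case 1
    then show ?thesis by (meson contract_crenameD red.contract)
  next
    case 2
    then show ?thesis using App.IH(1) by (metis crename.simps(7) red.appL)
  next
    case 3
    then show ?thesis using App.IH(2) by (metis crename.simps(7) red.appR)
  qed
next
  case (Catch t)
  from Catch.prems consider "contract (crename f (Catch t)) u"
    | t' where "red (crename (cup f) t) t'" "u = Catch t'"
    by (auto simp: red_Catch_iff)
  then show ?case
  proof cases
    case 1
    then show ?thesis by (meson contract_crenameD red.contract)
  next
    case 2
    then show ?thesis using Catch.IH by (metis crename.simps(8) red.catch)
  qed
next
  case (Throw \<alpha> t)
  from Throw.prems consider "contract (crename f (Throw \<alpha> t)) u"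
    | t' where "red (crename f t) t'" "u = Throw (f \<alpha>) t'"
    by (auto simp: red_Throw_iff)
  then show ?case
  proof cases
    case 1
    then show ?thesis by (meson contract_crenameD red.contract)
  next
    case 2
    then show ?thesis using Throw.IH by (metis crename.simps(9) red.throw)
  qed
qed auto

text \<open>The \<open>val\<close> conditions of call-by-value redexes survive because substituting
  a value into a value yields a value.\<close>

lemma contract_subst: "contract t u \<Longrightarrow> val w \<Longrightarrow> contract (subst t k w) (subst u k w)"
proof (cases t)
  case (App a b)
  moreover assume "contract t u" "val w"
  ultimately show ?thesis
    unfolding contract_App_iff App subst.simps
    by (elim disjE exE conjE) (simp_all add: val_subst subst_subst)
next
  case (Catch s)
  moreover assume "contract t u" "val w"
  ultimately show ?thesis
    unfolding contract_Catch_iff Catch subst.simps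
    by (elim disjE exE conjE) (simp_all add: val_subst clift_subst)
qed (auto simp: contract_Throw_iff)

lemma val_lift: "val t \<Longrightarrow> val (lift k t)"
  by (induction t rule: val.induct) auto

lemma red_subst: "red t u \<Longrightarrow> val w \<Longrightarrow> red (subst t k w) (subst u k w)"
  by (induction t u arbitrary: k w rule: red.induct)
    (auto intro: red.intros contract_subst val_lift val_clift)


section \<open>Strong normalization as accessibility\<close>

definition SN :: "trm \<Rightarrow> bool" where
  "SN = Wellfounded.accp (\<lambda>u t. red t u)"

lemma SN_I: "(\<And>u. red t u \<Longrightarrow> SN u) \<Longrightarrow> SN t"
  unfolding SN_def by (rule accpI)

lemma SN_red: "SN t \<Longrightarrow> red t u \<Longrightarrow> SN u"
  unfolding SN_def by (rule accp_downward)

lemma SN_reds: "red\<^sup>*\<^sup>* t u \<Longrightarrow> SN t \<Longrightarrow> SN u"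
  by (induction rule: rtranclp_induct) (auto intro: SN_red)

lemma SN_induct [consumes 1, case_names SN]:
  assumes "SN t" and "\<And>t. SN t \<Longrightarrow> (\<And>u. red t u \<Longrightarrow> P u) \<Longrightarrow> P t"
  shows "P t"
  using assms(1) unfolding SN_def
  by (induction rule: accp_induct_rule) (use assms(2) in \<open>auto simp: SN_def\<close>)

inductive sub :: "trm \<Rightarrow> trm \<Rightarrow> bool" where
  sub_AppL: "sub (t \<degree> s) t"
| sub_AppR: "sub (t \<degree> s) s"
| sub_Throw: "sub (Throw \<alpha> s) s"

lemma sub_size: "sub t s \<Longrightarrow> size s < size t"
  by (induction rule: sub.induct) auto

lemma sub_red: "sub t s \<Longrightarrow> red s s' \<Longrightarrow> \<exists>t'. red t t' \<and> sub t' s'"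
  by (induction rule: sub.induct) (auto intro: red.intros sub.intros)

lemma subs_red: "sub\<^sup>*\<^sup>* t s \<Longrightarrow> red s s' \<Longrightarrow> \<exists>t'. red t t' \<and> sub\<^sup>*\<^sup>* t' s'"
proof (induction arbitrary: s' rule: rtranclp_induct)
  case (step y z)
  then obtain y' where "red y y'" "sub y' s'"
    using sub_red by blast
  then show ?case using step.IH by (meson rtranclp.rtrancl_into_rtrancl)
qed auto

text \<open>Reduction of a subterm lifts to reduction of the whole term, so termination of
  reduction entails termination of reduction interleaved with passing to subterms.\<close>

lemma SN_sub_induct [consumes 1, case_names SN]:
  assumes "SN t"
    and step: "\<And>t. SN t \<Longrightarrow> (\<And>u. red t u \<Longrightarrow> P u) \<Longrightarrow> (\<And>u. sub t u \<Longrightarrow> P u) \<Longrightarrow> P t"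
  shows "P t"
proof -
  have "\<forall>s. sub\<^sup>*\<^sup>* t s \<longrightarrow> SN s \<and> P s"
    using assms(1)
  proof (induction t rule: SN_induct)
    case (SN t)
    have "sub\<^sup>*\<^sup>* t s \<Longrightarrow> SN s \<and> P s" for s
    \<comment> \<open>The order is lexicographic: a step from \<open>s\<close> lifts to a step from
      \<open>t\<close> and uses the outer induction, while passing to a subterm keeps
      \<open>t\<close> and decreases \<open>size\<close>.\<close>
    proof (induction s rule: measure_induct_rule[where f = size])
      case (less s)
      have "SN u \<and> P u" if "red s u" for u
        using SN.IH subs_red[OF less.prems that] by blast
      moreover have "P u" if "sub s u" for u
        using less sub_size[OF that] that by (meson rtranclp.rtrancl_into_rtrancl)
      ultimately show ?case
        using SN_I[of s] step[of s] by blast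
    qed
    then show ?case by blast
  qed
  then show ?thesis by blast
qed

lemma SN_sub: "SN t \<Longrightarrow> sub t s \<Longrightarrow> SN s"
proof (induction t arbitrary: s rule: SN_induct)
  case (SN t)
  show ?case
    by (rule SN_I) (use SN sub_red in blast)
qed

lemma SN_crename [simp]: "SN (crename f t) \<longleftrightarrow> SN t"
proof
  show "SN (crename f t) \<Longrightarrow> SN t"
  proof (induction "crename f t" arbitrary: t rule: SN_induct)
    case SN
    show ?case
      by (rule SN_I) (use SN red_crename in blast)
  qed
  show "SN t \<Longrightarrow> SN (crename f t)"
  proof (induction t rule: SN_induct)
    case (SN t)
    show ?case
      by (rule SN_I) (use SN red_crenameD in blast)
  qed
qed

text \<open>Each step of \<open>t\<close> is mirrored by a step of \<open>subst t k w\<close>. This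
  yields normalization of a \<open>Lam\<close> body from a single instance of it.\<close>

lemma SN_substD: "SN (subst t k w) \<Longrightarrow> val w \<Longrightarrow> SN t"
proof (induction "subst t k w" arbitrary: t rule: SN_induct)
  case SN
  show ?case
    by (rule SN_I) (use SN red_subst in blast)
qed

lemma SN_Lam: "SN t \<Longrightarrow> SN (Lam t)"
  by (induction t rule: SN_induct) (rule SN_I, auto simp: red_Lam_iff)

text \<open>A value is no redex and reduces only to values, so all steps of a partial or full
  constructor application take place in its components.\<close>

lemma SN_val_App: "SN t \<Longrightarrow> SN s \<Longrightarrow> val (t \<degree> s) \<Longrightarrow> SN (t \<degree> s)"
proof (induction t arbitrary: s rule: SN_induct)
  case (SN t)
  note t_IH = SN.IH
  from SN.prems show ?case
  proof (induction s rule: SN_induct)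
    case (SN s)
    note s_hyps = SN.hyps and s_IH = SN.IH and s_prems = SN.prems
    show ?case
    proof (rule SN_I)
      fix u assume u: "red (t \<degree> s) u"
      then have "val u" "\<not> contract (t \<degree> s) u"
        using s_prems red_val val_not_contract by blast+
      then show "SN u"
        using u s_hyps s_IH s_prems t_IH by (auto simp: red_App_iff simp del: val_simps)
    qed
  qed
qed

lemma SN_Throw: "SN t \<Longrightarrow> SN (Throw \<alpha> t)"
proof (induction t rule: SN_induct)
  case (SN t)
  then show ?case
    by - (rule SN_I, auto simp: red_Throw_iff contract_Throw_iff)
qed

text \<open>\<open>Catch (Throw 0 s)\<close> contracts to \<open>Catch s\<close>, where
  \<open>s\<close> is a subterm of the body and not a reduct of it; hence the induction on reduction
  mixed with subterms. When the binder is dropped, the contractum is the body up to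
  renaming.\<close>

lemma SN_Catch: "SN t \<Longrightarrow> SN (Catch t)"
proof (induction t rule: SN_sub_induct)
  case (SN t)
  show ?case
  proof (rule SN_I)
    fix u assume "red (Catch t) u"
    then consider s where "t = Throw 0 s" "u = Catch s" | "t = clift 0 u"
      | t' where "red t t'" "u = Catch t'"
      unfolding red_Catch_iff contract_Catch_iff by blast
    then show "SN u"
    proof cases
      case 1
      then show ?thesis using SN by (auto intro: sub.intros)
    next
      case 2
      then show ?thesis using SN.hyps by (simp add: clift_0_eq_crename)
    next
      case 3
      then show ?thesis using SN by simp
    qed
  qed
qed


section \<open>Reducibility\<close>

text \<open>A list value may end in a variable as well as in \<open>Nl\<close>; every tail that is
  not a full cons cell contributes no entries.\<close>

fun elems :: "trm \<Rightarrow> trm set" where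
  "elems (Cns \<degree> h \<degree> t) = insert h (elems t)"
| "elems _ = {}"

definition computes :: "(trm \<Rightarrow> bool) \<Rightarrow> trm \<Rightarrow> bool" where
  "computes P t \<longleftrightarrow> SN t \<and> (\<forall>v. red\<^sup>*\<^sup>* t v \<longrightarrow> val v \<longrightarrow> P v)"

text \<open>The predicate lives on raw terms, possibly open and ill-typed. At list types it
  constrains only the entries, so recursion on the type alone suffices.\<close>

primrec RV :: "ty \<Rightarrow> trm \<Rightarrow> bool" where
  "RV Unit_ty = (\<lambda>v. val v \<and> SN v)"
| "RV (List_ty \<sigma>) = (\<lambda>v. val v \<and> SN v \<and> (\<forall>h\<in>elems v. RV \<sigma> h))"
| "RV (\<sigma> \<rightarrow> \<tau>) = (\<lambda>v. val v \<and> SN v \<and> (\<forall>w. RV \<sigma> w \<longrightarrow> computes (RV \<tau>) (v \<degree> w)))"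

lemma RV_val: "RV \<tau> v \<Longrightarrow> val v"
  by (cases \<tau>) auto

lemma RV_SN: "RV \<tau> v \<Longrightarrow> SN v"
  by (cases \<tau>) auto

lemma computes_SN: "computes P t \<Longrightarrow> SN t"
  by (simp add: computes_def)

lemma computes_val: "computes P v \<Longrightarrow> val v \<Longrightarrow> P v"
  by (simp add: computes_def)

lemma computes_red: "computes P t \<Longrightarrow> red t u \<Longrightarrow> computes P u"
  by (auto simp: computes_def intro: SN_red converse_rtranclp_into_rtranclp)

text \<open>A value reached from a non-value is reached through some first reduct, so checking
  one-step reducts is enough.\<close>

lemma computes_nonval:
  assumes "\<not> val t" and "\<And>u. red t u \<Longrightarrow> computes P u"
  shows "computes P t"
  unfolding computes_def
proof (intro conjI allI impI)
  show "SN t" using assms(2) by (auto intro: SN_I computes_SN)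
  fix v assume "red\<^sup>*\<^sup>* t v" "val v"
  then obtain u where "red t u" "red\<^sup>*\<^sup>* u v"
    using assms(1) by (metis converse_rtranclpE)
  then show "P v" using assms(2) \<open>val v\<close> by (auto simp: computes_def)
qed

lemma elems_red: "val v \<Longrightarrow> red v u \<Longrightarrow> h \<in> elems u \<Longrightarrow> h \<in> elems v \<or> (\<exists>h'\<in>elems v. red h' h)"
proof (induction v arbitrary: u rule: val.induct)
  case (6 v w)
  then show ?case
    using val_not_contract[of v] by (fastforce simp: red_App_iff contract_App_iff)
qed (auto simp: red_iff contract_App_iff)

lemma RV_red: "RV \<tau> v \<Longrightarrow> red v u \<Longrightarrow> RV \<tau> u"
proof (induction \<tau> arbitrary: v u)
  case (List_ty \<sigma>)
  then have "RV \<sigma> h" if "h \<in> elems u" for h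
    using elems_red[of v u h] that by auto
  with List_ty show ?case by (auto intro: red_val SN_red)
next
  case (Arrow \<sigma> \<tau>)
  then show ?case by (auto intro: red_val SN_red computes_red red.appL)
qed (auto intro: red_val SN_red)

lemma RV_computes:
  assumes "RV \<tau> v"
  shows "computes (RV \<tau>) v"
proof -
  have "RV \<tau> u" if "red\<^sup>*\<^sup>* v u" for u
    using that assms by (induction rule: rtranclp_induct) (auto intro: RV_red)
  then show ?thesis using RV_SN[OF assms] by (simp add: computes_def)
qed

lemma elems_val_SN: "val v \<Longrightarrow> SN v \<Longrightarrow> h \<in> elems v \<Longrightarrow> val h \<and> SN h"
proof (induction v rule: elems.induct)
  case (1 h' t)
  have "SN t" "SN h'"
    using 1(3) by (meson SN_sub sub.intros)+
  then show ?case using 1 by auto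
qed auto

text \<open>The entries of a strongly normalizing list value are values and subterms of it, hence
  strongly normalizing; by induction the list clause then adds nothing.\<close>

lemma RV_arrow_free: "arrow_free \<psi> \<Longrightarrow> RV \<psi> v \<longleftrightarrow> val v \<and> SN v"
  by (induction \<psi> arbitrary: v) (auto dest: elems_val_SN)

lemma computes_arrow_free: "arrow_free \<psi> \<Longrightarrow> SN t \<Longrightarrow> computes (RV \<psi>) t"
  by (simp add: computes_def RV_arrow_free SN_reds)

section \<open>Invariance of reducibility under renaming of continuation variables\<close>

lemma reds_crename: "red\<^sup>*\<^sup>* t u \<Longrightarrow> red\<^sup>*\<^sup>* (crename f t) (crename f u)"
  by (induction rule: rtranclp_induct) (auto intro: rtranclp.rtrancl_into_rtrancl red_crename)

lemma reds_crenameD: "red\<^sup>*\<^sup>* (crename f t) u \<Longrightarrow> \<exists>u'. red\<^sup>*\<^sup>* t u' \<and> u = crename f u'"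
proof (induction rule: rtranclp_induct)
  case (step y z)
  then show ?case by (metis red_crenameD rtranclp.rtrancl_into_rtrancl)
qed auto

lemma computes_crename:
  assumes "\<And>v. P (crename f v) \<longleftrightarrow> P v"
  shows "computes P (crename f t) \<longleftrightarrow> computes P t"
  unfolding computes_def SN_crename
  by (metis assms reds_crename reds_crenameD val_crename)

lemma elems_crename: "elems (crename f v) = crename f ` elems v"
  by (induction v rule: elems.induct) auto

text \<open>In the arrow case the argument is not itself renamed; collapsing all continuation
  variables to one identifies the renamed application with the original one.\<close>

lemma RV_crename: "RV \<tau> (crename f v) \<longleftrightarrow> RV \<tau> v"
proof (induction \<tau> arbitrary: f v)
  case (List_ty \<sigma>)
  then show ?case by (simp add: elems_crename)
next
  case (Arrow \<sigma> \<tau>)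
  have "computes (RV \<tau>) (crename f v \<degree> w) \<longleftrightarrow> computes (RV \<tau>) (v \<degree> w)" for w
  proof -
    let ?c = "\<lambda>_::nat. 0::nat"
    have "crename ?c (crename f v \<degree> w) = crename ?c (v \<degree> w)"
      by (simp add: crename_crename comp_def)
    then show ?thesis
      using computes_crename[of "RV \<tau>" ?c] Arrow.IH(2) by metis
  qed
  then show ?case by simp
qed simp

lemma RV_clift: "RV \<tau> v \<Longrightarrow> RV \<tau> (clift 0 v)"
  by (simp add: clift_0_eq_crename RV_crename)

section \<open>Closure of reducibility under the term formers\<close>

lemma reds_Throw: "red\<^sup>*\<^sup>* (Throw \<alpha> t) u \<Longrightarrow> \<exists>\<beta> s. u = Throw \<beta> s"
  by (induction rule: rtranclp_induct) (auto simp: red_Throw_iff contract_Throw_iff)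

lemma computes_Throw: "SN (Throw \<alpha> t) \<Longrightarrow> computes P (Throw \<alpha> t)"
  by (auto simp: computes_def dest: reds_Throw)

lemma computes_App:
  assumes "computes (RV (\<sigma> \<rightarrow> \<tau>)) t" and "computes (RV \<sigma>) s"
  shows "computes (RV \<tau>) (t \<degree> s)"
proof -
  have "SN t" "SN s" using assms by (auto intro: computes_SN)
  then show ?thesis using assms
  proof (induction t arbitrary: s rule: SN_induct)
    case (SN t)
    note t_hyps = SN.hyps and t_IH = SN.IH and t_prems = SN.prems
    from t_prems show ?case
    proof (induction s rule: SN_induct)
      case (SN s)
      note s_hyps = SN.hyps and s_IH = SN.IH and s_prems = SN.prems
      show ?case
      proof (cases "val t \<and> val s")
        case True
        then have "RV (\<sigma> \<rightarrow> \<tau>) t" "RV \<sigma> s"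
          using s_prems by (auto intro: computes_val simp del: RV.simps)
        then show ?thesis by simp
      next
        case False
        show ?thesis
        proof (rule computes_nonval)
          show "\<not> val (t \<degree> s)" using False val_AppD by blast
          fix u assume "red (t \<degree> s) u"
          then consider "contract (t \<degree> s) u" | t' where "red t t'" "u = t' \<degree> s"
            | s' where "red s s'" "u = t \<degree> s'"
            by (auto simp: red_App_iff)
          then show "computes (RV \<tau>) u"
          proof cases
            case 1
            \<comment> \<open>Beta and the \<open>LRec\<close> rules require both \<open>t\<close>
              and \<open>s\<close> to be values, so only a \<open>Throw\<close> can be propagated
              here, and it is \<open>t\<close> or \<open>s\<close> itself.\<close>
            then have "(\<exists>\<alpha> r. u = Throw \<alpha> r) \<and> (u = t \<or> u = s)"
              using False by (auto simp: contract_App_iff)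
            then show ?thesis using t_hyps s_hyps computes_Throw by metis
          next
            case 2
            then show ?thesis using t_IH s_hyps s_prems computes_red by blast
          next
            case 3
            then show ?thesis using s_IH s_prems computes_red by blast
          qed
        qed
      qed
    qed
  qed
qed

lemma computes_Var_App: "SN w \<Longrightarrow> val w \<Longrightarrow> computes P (Var i \<degree> w)"
proof (induction w rule: SN_induct)
  case (SN w)
  then show ?case
    by - (rule computes_nonval, auto simp: red_App_iff contract_App_iff dest: red_val)
qed

text \<open>At arrow types this holds because \<open>Var i\<close> applied to a value never becomes
  a value. Variables thus inhabit every type, which is needed for reduction under \<open>Lam\<close>
  and for the identity substitution.\<close>

lemma RV_Var: "RV \<tau> (Var i)"
proof -
  have "SN (Var i)" by (rule SN_I) simp
  then show ?thesis by (cases \<tau>) (auto intro: computes_Var_App RV_SN RV_val)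
qed

lemma RV_Lam:
  assumes "\<And>w. RV \<sigma> w \<Longrightarrow> computes (RV \<tau>) (subst t 0 w)"
  shows "RV (\<sigma> \<rightarrow> \<tau>) (Lam t)"
proof -
  \<comment> \<open>The hypothesis is instantiated with a variable, a reducible value of any
    type.\<close>
  have "SN t"
    using computes_SN[OF assms[OF RV_Var[of \<sigma> 0]]] by (rule SN_substD) simp
  moreover have "computes (RV \<tau>) (Lam t \<degree> w)" if "RV \<sigma> w" for w
    using \<open>SN t\<close> assms RV_SN[OF that] that
  proof (induction t arbitrary: w rule: SN_induct)
    case (SN t)
    note t_hyps = SN.hyps and t_IH = SN.IH and t_prems = SN.prems
    from t_prems(2,3) show ?case
    proof (induction w rule: SN_induct)
      case (SN w)
      note w_hyps = SN.hyps and w_IH = SN.IH and w_prems = SN.prems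
      show ?case
      proof (rule computes_nonval)
        fix u assume "red (Lam t \<degree> w) u"
        then consider "u = subst t 0 w" | t' where "red t t'" "u = Lam t' \<degree> w"
          | w' where "red w w'" "u = Lam t \<degree> w'"
          using RV_val[OF w_prems] by (auto simp: red_App_iff red_Lam_iff contract_App_iff)
        then show "computes (RV \<tau>) u"
        proof cases
          case 1
          then show ?thesis using t_prems(1) w_prems by simp
        next
          case 2
          \<comment> \<open>For every reducible value, the instance of \<open>t'\<close> is a reduct
            of the instance of \<open>t\<close>, so the hypothesis on instances passes to
            \<open>t'\<close>.\<close>
          then show ?thesis
            using t_IH[OF 2(1) _ w_hyps w_prems] t_prems(1)
            by (meson RV_val computes_red red_subst)
        next
          case 3
          then show ?thesis using w_IH w_prems RV_red by blast
        qed
      qed simp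
    qed
  qed
  ultimately show ?thesis by (simp add: SN_Lam)
qed

lemma SN_atom: "SN Unit" "SN Nl" "SN Cns" "SN LRec"
  by (rule SN_I, simp)+

lemma RV_Cns: "RV (\<sigma> \<rightarrow> List_ty \<sigma> \<rightarrow> List_ty \<sigma>) Cns"
proof -
  have "RV (List_ty \<sigma>) (Cns \<degree> h \<degree> t)" if "RV \<sigma> h" "RV (List_ty \<sigma>) t" for h t
    using that RV_val[OF that(1)] RV_SN[OF that(1)] by (auto intro!: SN_val_App SN_atom)
  then have "RV (List_ty \<sigma> \<rightarrow> List_ty \<sigma>) (Cns \<degree> h)" if "RV \<sigma> h" for h
    unfolding RV.simps(3)[of "List_ty \<sigma>"]
    using that RV_val[OF that] RV_SN[OF that]
    by (auto intro!: SN_val_App SN_atom RV_computes simp del: RV.simps)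
  then show ?thesis
    unfolding RV.simps(3)[of \<sigma> "List_ty \<sigma> \<rightarrow> List_ty \<sigma>"]
    by (auto intro!: SN_atom RV_computes simp del: RV.simps)
qed

text \<open>The inductions on \<open>l\<close>, \<open>r\<close> and \<open>s\<close> are nested
  with \<open>l\<close> outermost: the recursive call keeps \<open>r\<close> and \<open>s\<close>
  and goes to the tail, a subterm of \<open>l\<close> and not a reduct. This is why \<open>l\<close>
  uses the mixed induction.\<close>

lemma computes_LRec:
  assumes "RV (List_ty \<sigma>) l" "RV \<rho> r" "RV (\<sigma> \<rightarrow> List_ty \<sigma> \<rightarrow> \<rho> \<rightarrow> \<rho>) s"
  shows "computes (RV \<rho>) (LRec \<degree> r \<degree> s \<degree> l)"
proof -
  have "SN l" using assms(1) by (rule RV_SN)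
  then show ?thesis using assms
  proof (induction l arbitrary: r s rule: SN_sub_induct)
    case (SN l)
    note l_hyps = SN.hyps and l_IH = SN.IH and l_prems = SN.prems
    have "SN r" using l_prems(2) by (rule RV_SN)
    then show ?case using l_prems(2,3)
    proof (induction r arbitrary: s rule: SN_induct)
      case (SN r)
      note r_hyps = SN.hyps and r_IH = SN.IH and r_prems = SN.prems
      have "SN s" using r_prems(2) by (rule RV_SN)
      then show ?case using r_prems(2)
      proof (induction s rule: SN_induct)
        case (SN s)
        note s_hyps = SN.hyps and s_IH = SN.IH and s_prems = SN.prems
        note vals = RV_val[OF l_prems(1)] RV_val[OF r_prems(1)] RV_val[OF s_prems]
        show ?case
        proof (rule computes_nonval)
          fix u assume "red (LRec \<degree> r \<degree> s \<degree> l) u"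
          then consider "contract (LRec \<degree> r \<degree> s \<degree> l) u"
            | v where "red (LRec \<degree> r \<degree> s) v" "u = v \<degree> l"
            | l' where "red l l'" "u = LRec \<degree> r \<degree> s \<degree> l'"
            by (auto simp: red_App_iff)
          then show "computes (RV \<rho>) u"
          proof cases
            case 1
            then consider "u = r"
              | h t where "l = Cns \<degree> h \<degree> t" "u = s \<degree> h \<degree> t \<degree> (LRec \<degree> r \<degree> s \<degree> t)"
              using vals by (auto simp: contract_App_iff)
            then show ?thesis
            proof cases
              case 1
              then show ?thesis using r_prems(1) by (simp add: RV_computes)
            next
              case 2
              have sub: "sub l t" using 2 by (auto intro: sub.intros)
              \<comment> \<open>The entries of the tail are among those of \<open>l\<close>, and the
                tail is a value and normalizes as a subterm of \<open>l\<close>.\<close>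
              have h: "RV \<sigma> h" and t: "RV (List_ty \<sigma>) t"
                using l_prems(1) 2 vals(1) SN_sub[OF l_hyps sub] by auto
              show ?thesis
                unfolding 2(2)
                using l_IH(2)[OF sub t r_prems(1) s_prems] h t s_prems
                by (blast intro: computes_App RV_computes)
            qed
          next
            case 2
            then consider r' where "red r r'" "v = LRec \<degree> r' \<degree> s"
              | s' where "red s s'" "v = LRec \<degree> r \<degree> s'"
              using vals by (auto simp: red_App_iff contract_App_iff)
            then show ?thesis
              using 2(2) r_IH r_prems(1) s_IH s_prems RV_red by cases blast+
          next
            case 3
            then show ?thesis
              using l_IH(1) l_prems(1) r_prems(1) s_prems RV_red by blast
          qed
        qed simp
      qed
    qed
  qed
qed

lemma RV_LRec: "RV (\<rho> \<rightarrow> (\<sigma> \<rightarrow> List_ty \<sigma> \<rightarrow> \<rho> \<rightarrow> \<rho>) \<rightarrow> List_ty \<sigma> \<rightarrow> \<rho>) LRec"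
proof -
  let ?S = "\<sigma> \<rightarrow> List_ty \<sigma> \<rightarrow> \<rho> \<rightarrow> \<rho>"
  have "RV (List_ty \<sigma> \<rightarrow> \<rho>) (LRec \<degree> r \<degree> s)" if "RV \<rho> r" "RV ?S s" for r s
    unfolding RV.simps(3)[of "List_ty \<sigma>"]
    using that that[THEN RV_val] that[THEN RV_SN]
    by (auto intro!: SN_val_App SN_atom computes_LRec simp del: RV.simps)
  then have "RV (?S \<rightarrow> List_ty \<sigma> \<rightarrow> \<rho>) (LRec \<degree> r)" if "RV \<rho> r" for r
    unfolding RV.simps(3)[of ?S]
    using that RV_val[OF that] RV_SN[OF that]
    by (auto intro!: SN_val_App SN_atom RV_computes simp del: RV.simps)
  then show ?thesis
    unfolding RV.simps(3)[of \<rho> "?S \<rightarrow> List_ty \<sigma> \<rightarrow> \<rho>"]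
    by (auto intro!: SN_atom RV_computes simp del: RV.simps)
qed

text \<open>The fundamental lemma. \<open>\<Delta>\<close> carries no semantic condition:
  \<open>Throw\<close> needs only normalization of its argument, and \<open>Catch\<close> has an
  arrow-free type, where normalization is reducibility.\<close>

theorem typing_computes:
  assumes "typing \<Gamma> \<Delta> t \<rho>" and "\<And>i. i < length \<Gamma> \<Longrightarrow> RV (\<Gamma> ! i) (\<theta> i)"
  shows "computes (RV \<rho>) (psubst t \<theta>)"
  using assms
proof (induction arbitrary: \<theta> rule: typing.induct)
  case (var i \<Gamma> \<rho> \<Delta>)
  then show ?case by (auto intro: RV_computes)
next
  case (unit \<Gamma> \<Delta>)
  show ?case unfolding psubst.simps by (rule RV_computes) (simp add: SN_atom)
next
  case (nil \<Gamma> \<Delta> \<sigma>)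
  show ?case unfolding psubst.simps by (rule RV_computes) (simp add: SN_atom)
next
  case (cons \<Gamma> \<Delta> \<sigma>)
  show ?case unfolding psubst.simps by (intro RV_computes RV_Cns)
next
  case (lrec \<Gamma> \<Delta> \<rho> \<sigma>)
  show ?case unfolding psubst.simps by (intro RV_computes RV_LRec)
next
  case (lam \<sigma> \<Gamma> \<Delta> t \<tau>)
  have "RV ((\<sigma> # \<Gamma>) ! i) (case_nat w \<theta> i)" if "RV \<sigma> w" "i < length (\<sigma> # \<Gamma>)" for w i
    using that lam.prems by (cases i) auto
  then have "computes (RV \<tau>) (psubst t (case_nat w \<theta>))" if "RV \<sigma> w" for w
    using that by (intro lam.IH)
  then show ?case
    unfolding psubst.simps by - (rule RV_computes, rule RV_Lam, simp add: subst_psubst_up)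
next
  case (app \<Gamma> \<Delta> t \<sigma> \<tau> s)
  then show ?case unfolding psubst.simps by (blast intro: computes_App)
next
  case (catch \<psi> \<Gamma> \<Delta> t)
  then have "computes (RV \<psi>) (psubst t (\<lambda>i. clift 0 (\<theta> i)))"
    by (intro catch.IH RV_clift)
  with catch.hyps(1) show ?case
    by (auto intro: computes_arrow_free SN_Catch computes_SN)
next
  case (throw \<psi> \<Gamma> \<Delta> t \<alpha> \<tau>)
  then have "computes (RV \<psi>) (psubst t \<theta>)"
    by (intro throw.IH)
  then show ?case by (auto intro: computes_Throw SN_Throw computes_SN)
qed


section \<open>Bounded reduction sequences\<close>

lemma finite_contract: "finite {u. contract t u}"
proof (cases t)
  case (App a b)
  let ?A = "case a of Lam t \<Rightarrow> {subst t 0 b} | _ \<Rightarrow> {}"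
  let ?B = "case a of LRec \<degree> r \<degree> s \<Rightarrow> {r} | _ \<Rightarrow> {}"
  let ?C = "case a of LRec \<degree> r \<degree> s \<Rightarrow>
    (case b of Cns \<degree> h \<degree> t \<Rightarrow> {s \<degree> h \<degree> t \<degree> (LRec \<degree> r \<degree> s \<degree> t)} | _ \<Rightarrow> {}) | _ \<Rightarrow> {}"
  have "{u. contract t u} \<subseteq> {a, b} \<union> ?A \<union> ?B \<union> ?C"
    unfolding App contract_App_iff by auto
  moreover have "finite ?A" "finite ?B" "finite ?C"
    by (auto split: trm.split)
  ultimately show ?thesis by (meson finite.emptyI finite_UnI finite_insert finite_subset)
next
  case (Catch s)
  \<comment> \<open>If \<open>s = clift 0 u\<close>, then \<open>u\<close> is determined as
    \<open>clower 0 s\<close>.\<close>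
  have "{u. contract t u} \<subseteq> (case s of Throw \<alpha> r \<Rightarrow> {Catch r} | _ \<Rightarrow> {}) \<union> {clower 0 s}"
    unfolding Catch contract_Catch_iff by (auto simp: clower_clift)
  moreover have "finite (case s of Throw \<alpha> r \<Rightarrow> {Catch r} | _ \<Rightarrow> {})"
    by (auto split: trm.split)
  ultimately show ?thesis by (meson finite.emptyI finite_UnI finite_insert finite_subset)
next
  case (Throw \<alpha> s)
  have "{u. contract t u} \<subseteq> {s}"
    unfolding Throw contract_Throw_iff by auto
  then show ?thesis by (meson finite.emptyI finite_insert finite_subset)
qed auto

lemma finite_red: "finite {u. red t u}"
proof (induction t)
  case (Lam t)
  have "{u. red (Lam t) u} = Lam ` {u. red t u}"
    by (auto simp: red_Lam_iff)
  with Lam show ?case by simp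
next
  case (App a b)
  have "{u. red (a \<degree> b) u} =
      {u. contract (a \<degree> b) u} \<union> (\<lambda>u. u \<degree> b) ` {u. red a u} \<union> (\<lambda>u. a \<degree> u) ` {u. red b u}"
    by (auto simp: red_App_iff)
  with App show ?case by (simp add: finite_contract)
next
  case (Catch t)
  have "{u. red (Catch t) u} = {u. contract (Catch t) u} \<union> Catch ` {u. red t u}"
    by (auto simp: red_Catch_iff)
  with Catch show ?case by (simp add: finite_contract)
next
  case (Throw \<alpha> t)
  have "{u. red (Throw \<alpha> t) u} = {u. contract (Throw \<alpha> t) u} \<union> Throw \<alpha> ` {u. red t u}"
    by (auto simp: red_Throw_iff)
  with Throw show ?case by (simp add: finite_contract)
qed auto

lemma SN_imp_strongly_normalizing: "SN t \<Longrightarrow> strongly_normalizing t"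
proof (induction t rule: SN_induct)
  case (SN t)
  then have "\<forall>u\<in>{u. red t u}. \<exists>n. \<forall>k s. (red ^^ k) u s \<longrightarrow> k \<le> n"
    by (simp add: strongly_normalizing_def)
  then obtain b where b: "\<And>u k s. red t u \<Longrightarrow> (red ^^ k) u s \<Longrightarrow> k \<le> b u"
    by (metis mem_Collect_eq)
  \<comment> \<open>The sum over the finitely many reducts dominates each of their bounds and is 0
    for a normal form; \<open>Suc\<close> counts the first step.\<close>
  have "k \<le> Suc (\<Sum>u | red t u. b u)" if "(red ^^ k) t s" for k s
  proof (cases k)
    case (Suc k')
    with that obtain u where u: "red t u" "(red ^^ k') u s"
      by (metis relpowp_Suc_D2)
    have "b u \<le> (\<Sum>u | red t u. b u)"
      using u(1) finite_red by (intro member_le_sum) auto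
    with b[OF u] Suc show ?thesis by simp
  qed simp
  then show ?case unfolding strongly_normalizing_def by blast
qed

theorem theorem4p18:
  fixes \<Gamma> \<Delta> :: "ty list" and t :: trm and \<rho> :: ty
  assumes "\<forall>\<psi>\<in>set \<Delta>. arrow_free \<psi>"
    and "typing \<Gamma> \<Delta> t \<rho>"
  shows "strongly_normalizing t"
proof -
  \<comment> \<open>The identity substitution is reducible by \<open>RV_Var\<close> and leaves
    \<open>t\<close> unchanged by \<open>psubst_Var\<close>.\<close>
  have "computes (RV \<rho>) (psubst t Var)"
    using assms(2) RV_Var by (rule typing_computes)
  then show ?thesis
    by (simp add: psubst_Var computes_SN SN_imp_strongly_normalizing)
qed

end
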